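(* Let $\lambda,\mu$ be sigma-finite measures on a measurable space $S$ admitting densities $f=\frac{d\lambda}{d\nu}$, $g=\frac{d\mu}{d\nu}$ (measurable functions $S\to[0,\infty)$) with respect to a sigma-finite measure $\nu$ on $S$, and let $T_\alpha(\lambda\|\mu)$, $\alpha\in[0,\infty)$, be the Tsallis divergence. Then $\alpha\mapsto T_\alpha(\lambda\|\mu)$ is a well-defined nondecreasing function from $[0,\infty)$ into $[0,\infty]$ that is continuous on the interval $\{\alpha\in[0,\infty) : T_\alpha(\lambda\|\mu)<\infty\}$, and it admits the representation $$T_\alpha(\lambda\|\mu)=\int_S R_\alpha(p_{f(x)}\|p_{g(x)})\,\nu(dx),$$ where $p_s$ denotes the Poisson distribution $k\mapsto e^{-s}\frac{s^k}{k!}$ on the nonnegative integers with mean $s\in[0,\infty)$ ($p_0=\delta_0$), and $R_\alpha$ is the R\'enyi divergence. Furthermore, the value of $T_\alpha(\lambda\|\mu)$ does not depend on the choice of the densities $f,g$ nor of the measure $\nu$.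
   Context: Density: $f=\frac{d\lambda}{d\nu}$ means $\lambda(A)=\int_A f\,d\nu$ for all measurable $A$. Conventions: for $\alpha>1$, $f^\alpha g^{1-\alpha}$ is read as $\frac{f^\alpha}{g^{\alpha-1}}$; $\frac00=0$ and $\frac t0=\infty$ for $t>0$; $t\log\frac t0=\infty$ for $t>0$; $0\log\frac0t=0$ for $t\ge0$. Tsallis divergence of order $\alpha\in[0,\infty)$ of sigma-finite measures $\lambda,\mu$ with densities $f,g$ with respect to a sigma-finite measure $\nu$: $$T_\alpha(\lambda\|\mu)=\begin{cases}\mu\{f=0\},&\alpha=0,\\ \int_S\frac{\alpha f+(1-\alpha)g-f^\alpha g^{1-\alpha}}{1-\alpha}\,d\nu,&\alpha\notin\{0,1\},\\ \int_S\left(f\log\frac fg+g-f\right)d\nu,&\alpha=1.\end{cases}$$ R\'enyi divergence of order $\alpha\in[0,\infty)$ of probability measures $P,Q$ with densities $p,q$ with respect to a sigma-finite measure $m$ (the value does not depend on the choice), with the same conventions: $R_0(P\|Q)=-\log Q(p>0)$; $R_\alpha(P\|Q)=\frac1{\alpha-1}\log\int p^\alpha q^{1-\alpha}\,dm$ for $\alpha\notin\{0,1\}$; $R_1(P\|Q)=\int p\log\frac pq\,dm$. *)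

theory Defs
  imports "HOL-Probability.Probability"
begin

definition is_real_density :: "'a measure \<Rightarrow> 'a measure \<Rightarrow> ('a \<Rightarrow> real) \<Rightarrow> bool" where
  "is_real_density M N f \<longleftrightarrow>
     f \<in> borel_measurable N \<and> (\<forall>x\<in>space N. 0 \<le> f x) \<and> M = density N (\<lambda>x. ennreal (f x))"

text \<open>Integral of an extended real function, as the difference of the integrals of its positive
  and negative parts (\<^const>\<open>e2ennreal\<close> sends negative arguments to 0). The value is
  meaningful only under \<open>ext_integral_exists\<close>.\<close>

definition ext_integral_exists :: "'a measure \<Rightarrow> ('a \<Rightarrow> ereal) \<Rightarrow> bool" where
  "ext_integral_exists M h \<longleftrightarrow> h \<in> borel_measurable M \<and>
     ((\<integral>\<^sup>+x. e2ennreal (h x) \<partial>M) < \<infinity> \<or> (\<integral>\<^sup>+x. e2ennreal (- h x) \<partial>M) < \<infinity>)"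

definition ext_integral :: "'a measure \<Rightarrow> ('a \<Rightarrow> ereal) \<Rightarrow> ereal" where
  "ext_integral M h =
     enn2ereal (\<integral>\<^sup>+x. e2ennreal (h x) \<partial>M) - enn2ereal (\<integral>\<^sup>+x. e2ennreal (- h x) \<partial>M)"

definition ext_log :: "ennreal \<Rightarrow> ereal" where
  "ext_log x = (if x = 0 then - \<infinity> else if x = \<infinity> then \<infinity> else ereal (ln (enn2real x)))"

text \<open>The expression \<open>s\<^sup>a t\<^sup>1\<^sup>-\<^sup>a\<close> for \<open>a \<notin> {0, 1}\<close>. Division on
  \<^typ>\<open>ennreal\<close> satisfies \<open>0 / 0 = 0\<close> and \<open>t / 0 = \<infinity>\<close> for \<open>t > 0\<close>.\<close>

definition mixed_power :: "real \<Rightarrow> real \<Rightarrow> real \<Rightarrow> ennreal" where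
  "mixed_power a s t =
     (if a > 1 then ennreal (s powr a) / ennreal (t powr (a - 1))
      else ennreal (s powr a * t powr (1 - a)))"

text \<open>The expression \<open>s log (s / t)\<close>.\<close>

definition mult_log_quot :: "real \<Rightarrow> real \<Rightarrow> ereal" where
  "mult_log_quot s t = (if s = 0 then 0 else if t = 0 then \<infinity> else ereal (s * ln (s / t)))"

definition tsallis_integrand :: "real \<Rightarrow> real \<Rightarrow> real \<Rightarrow> ereal" where
  "tsallis_integrand a s t =
     (if a = 1 then mult_log_quot s t + ereal (t - s)
      else (ereal (a * s + (1 - a) * t) - enn2ereal (mixed_power a s t)) / ereal (1 - a))"

text \<open>Tsallis divergence of \<open>\<lambda> = f \<nu>\<close> and \<open>\<mu> = g \<nu>\<close>.\<close>

definition tsallis :: "real \<Rightarrow> 'a measure \<Rightarrow> ('a \<Rightarrow> real) \<Rightarrow> ('a \<Rightarrow> real) \<Rightarrow> ereal" where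
  "tsallis a N f g =
     (if a = 0 then enn2ereal (emeasure (density N (\<lambda>x. ennreal (g x))) {x \<in> space N. f x = 0})
      else ext_integral N (\<lambda>x. tsallis_integrand a (f x) (g x)))"

definition renyi_of_densities :: "real \<Rightarrow> 'a measure \<Rightarrow> ('a \<Rightarrow> real) \<Rightarrow> ('a \<Rightarrow> real) \<Rightarrow> ereal" where
  "renyi_of_densities a M p q =
     (if a = 0 then - ext_log (emeasure (density M (\<lambda>x. ennreal (q x))) {x \<in> space M. p x > 0})
      else if a = 1 then ext_integral M (\<lambda>x. mult_log_quot (p x) (q x))
      else ereal (1 / (a - 1)) * ext_log (\<integral>\<^sup>+x. mixed_power a (p x) (q x) \<partial>M))"

text \<open>R\'enyi divergence of probability measures: the common value over all sigma-finite dominating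
  measures and all densities.\<close>

definition renyi :: "real \<Rightarrow> 'a measure \<Rightarrow> 'a measure \<Rightarrow> ereal" where
  "renyi a P Q = (THE r. \<exists>M p q. sigma_finite_measure M \<and>
     is_real_density P M p \<and> is_real_density Q M q \<and> r = renyi_of_densities a M p q)"

text \<open>The library's \<^const>\<open>poisson_pmf\<close> is specified only for positive rates.\<close>

definition poisson :: "real \<Rightarrow> nat pmf" where
  "poisson s = (if s = 0 then return_pmf 0 else poisson_pmf s)"

end

theory Submission
  imports Defs
begin

text \<open>For \<open>s, t > 0\<close> the Tsallis integrand equals \<open>t - s\<close> plus \<open>t\<close> times the slope of the chord of
  the convex function \<open>a \<mapsto> (s / t)\<^sup>a\<close> between \<open>a\<close> and \<open>1\<close>, so it is nondecreasing and continuous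
  in \<open>a\<close>, and nonnegative because it vanishes at \<open>a = 0\<close>. Integration preserves monotonicity, and
  dominated convergence preserves continuity wherever the integral is finite. Summing the
  exponential series identifies the integrand with the R\'enyi divergence of two Poisson
  distributions. Since the integrand is positively homogeneous in \<open>(s, t)\<close>, its integral
  can be rewritten as an integral over \<open>\<lambda> + \<mu> = (f + g) \<nu>\<close> of the essentially unique densities of
  \<open>\<lambda>\<close> and \<open>\<mu>\<close> with respect to that measure, so it does not depend on \<open>\<nu>\<close>, \<open>f\<close>, \<open>g\<close>. The same
  argument shows that the R\'enyi divergence is well defined.\<close>

section \<open>Chord slopes of the exponential function\<close>

text \<open>Slope of the chord of \<open>a \<mapsto> exp (a * r)\<close> between \<open>a\<close>
  and \<open>1\<close>, with the derivative \<open>r * exp r\<close> filled in where the chord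
  degenerates. It is applied with \<open>r = ln (s / t)\<close>.\<close>

definition exp_slope :: "real \<Rightarrow> real \<Rightarrow> real" where
  "exp_slope r a = (if a = 1 then r * exp r else (exp (a * r) - exp r) / (a - 1))"

lemma convex_on_exp_mult: "convex_on UNIV (\<lambda>a::real. exp (a * r))"
  by (rule f''_ge0_imp_convex[where f' = "\<lambda>a. r * exp (a * r)" and f'' = "\<lambda>a. r * r * exp (a * r)"])
    (auto intro!: derivative_eq_intros)

text \<open>This is \<open>1 + x \<le> exp x\<close> at \<open>x = (a - 1) * r\<close>, scaled by
  \<open>exp r\<close>. The tangent at \<open>1\<close> lying below the graph is what compares
  chords with the value filled in at \<open>1\<close>.\<close>

lemma exp_mult_ge_tangent:
  fixes a r :: real
  shows "exp r * (1 + (a - 1) * r) \<le> exp (a * r)"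
proof -
  have "exp r * (1 + (a - 1) * r) \<le> exp r * exp ((a - 1) * r)"
    by (intro mult_left_mono) auto
  also have "\<dots> = exp (a * r)"
    by (simp add: algebra_simps flip: exp_add)
  finally show ?thesis .
qed

lemma exp_slope_le_tangent:
  assumes "a < 1"
  shows "exp_slope r a \<le> exp_slope r 1"
  using assms exp_mult_ge_tangent[of r a]
  by (simp add: exp_slope_def divide_simps) (simp add: algebra_simps)

lemma tangent_le_exp_slope:
  assumes "1 < a"
  shows "exp_slope r 1 \<le> exp_slope r a"
  using assms exp_mult_ge_tangent[of r a]
  by (simp add: exp_slope_def divide_simps) (simp add: algebra_simps)

text \<open>On either side of \<open>1\<close> this is the chord inequality for convex functions;
  across \<open>1\<close> the tangent slope \<open>exp_slope r 1\<close> separates the two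
  chords.\<close>

lemma mono_exp_slope: "mono (exp_slope r)"
proof
  fix x y :: real
  assume "x \<le> y"
  consider "x = y" | "x < y" "y < 1" | "1 < x" "x < y" | "x \<le> 1" "1 \<le> y"
    using \<open>x \<le> y\<close> by linarith
  then show "exp_slope r x \<le> exp_slope r y"
  proof cases
    case 2
    then show ?thesis
      using convex_on_slope_le(2)[OF convex_on_exp_mult, of x 1 y r] by (simp add: exp_slope_def)
  next
    case 3
    then have "(exp r - exp (x * r)) / (1 - x) \<le> (exp r - exp (y * r)) / (1 - y)"
      using convex_on_slope_le(1)[OF convex_on_exp_mult, of 1 y x r] by simp
    with 3 show ?thesis
      by (simp add: exp_slope_def) (metis minus_diff_eq minus_divide_divide)
  next
    case 4
    then show ?thesis
      using exp_slope_le_tangent[of x r] tangent_le_exp_slope[of y r]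
      by (cases "x = 1"; cases "y = 1") auto
  qed auto
qed

text \<open>Away from \<open>1\<close> this is a quotient of continuous functions; at
  \<open>1\<close> the chord slopes converge to the derivative by its definition.\<close>

lemma continuous_on_exp_slope: "continuous_on A (exp_slope r)"
proof -
  have "isCont (exp_slope r) a" for a
  proof (cases "a = 1")
    case True
    have "((\<lambda>a. exp (a * r)) has_field_derivative r * exp r) (at 1)"
      by (auto intro!: derivative_eq_intros)
    then have "((\<lambda>y. (exp (y * r) - exp (1 * r)) / (y - 1)) \<longlongrightarrow> r * exp r) (at 1)"
      by (simp add: has_field_derivative_iff)
    then have "(exp_slope r \<longlongrightarrow> r * exp r) (at 1)"
      by (rule Lim_transform_eventually) (auto simp: exp_slope_def eventually_at_filter)
    with True show ?thesis
      by (simp add: isCont_def exp_slope_def)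
  next
    case False
    have ev: "\<forall>\<^sub>F x in nhds a. exp_slope r x = (exp (x * r) - exp r) / (x - 1)"
      using t1_space_nhds[OF False] by eventually_elim (simp add: exp_slope_def)
    show ?thesis
      unfolding isCont_cong[OF ev] using False by (intro continuous_intros) auto
  qed
  then show ?thesis
    by (simp add: continuous_at_imp_continuous_on)
qed

section \<open>The Tsallis integrand as a function of the order\<close>

lemma tsallis_integrand_zero_left:
  assumes "0 \<le> a" "0 \<le> t"
  shows "tsallis_integrand a 0 t = ereal t"
  using assms by (auto simp: tsallis_integrand_def mult_log_quot_def mixed_power_def zero_ennreal.rep_eq)

text \<open>The mixed power is \<open>0\<close> for \<open>a < 1\<close> and
  \<open>\<infinity>\<close> for \<open>a > 1\<close>; in the latter case dividing
  \<open>- \<infinity>\<close> by the negative number \<open>1 - a\<close> gives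
  \<open>\<infinity>\<close>.\<close>

lemma tsallis_integrand_zero_right:
  assumes "0 \<le> a" "0 < s"
  shows "tsallis_integrand a s 0 = (if a < 1 then ereal (a * s / (1 - a)) else \<infinity>)"
  using assms
  by (auto simp: tsallis_integrand_def mult_log_quot_def mixed_power_def
      ennreal_divide_eq_top_iff ennreal_divide_zero zero_ennreal.rep_eq)

text \<open>For positive arguments both branches of \<open>mixed_power\<close> equal
  \<open>t * (s / t) powr a\<close>, so orders below and above \<open>1\<close> can be treated
  alike.\<close>

lemma mixed_power_pos:
  assumes "0 < s" "0 < t"
  shows "mixed_power a s t = ennreal (t * exp (a * ln (s / t)))"
proof -
  have *: "s powr a * t powr (1 - a) = t * exp (a * ln (s / t))"
    using assms by (simp add: powr_def ln_div ring_distribs exp_diff exp_minus field_simps flip: exp_add)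
  show ?thesis
    using assms * by (auto simp: mixed_power_def divide_ennreal powr_diff field_simps)
qed

text \<open>At order \<open>1\<close> the value filled into \<open>exp_slope\<close> contributes
  \<open>s * ln (s / t)\<close>, because \<open>exp (ln (s / t)) = s / t\<close>.\<close>

lemma tsallis_integrand_pos:
  assumes "0 < s" "0 < t"
  shows "tsallis_integrand a s t = ereal (t - s + t * exp_slope (ln (s / t)) a)"
proof (cases "a = 1")
  case True
  with assms show ?thesis
    by (simp add: tsallis_integrand_def mult_log_quot_def exp_slope_def)
next
  case False
  have "exp (ln (s / t)) = s / t"
    using assms by simp
  with False assms show ?thesis
    by (simp add: tsallis_integrand_def mixed_power_pos exp_slope_def enn2ereal_ennreal divide_simps)
      (simp add: algebra_simps)
qed

lemma tsallis_integrand_mono: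
  assumes "0 \<le> s" "0 \<le> t" "0 \<le> a" "a \<le> b"
  shows "tsallis_integrand a s t \<le> tsallis_integrand b s t"
proof -
  consider "s = 0" | "0 < s" "t = 0" | "0 < s" "0 < t"
    using assms by linarith
  then show ?thesis
  proof cases
    case 1
    with assms show ?thesis
      by (simp add: tsallis_integrand_zero_left)
  next
    case 2
    have "a * s / (1 - a) \<le> b * s / (1 - b)" if "b < 1"
      using that assms by (intro frac_le mult_right_mono mult_nonneg_nonneg) auto
    with 2 assms show ?thesis
      by (auto simp: tsallis_integrand_zero_right)
  next
    case 3
    with assms show ?thesis
      by (auto simp: tsallis_integrand_pos intro!: mult_left_mono monoD[OF mono_exp_slope])
  qed
qed

text \<open>The value \<open>0 powr 0 = 0\<close> makes \<open>mixed_power 0 s t\<close> equal to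
  \<open>t\<close> for \<open>s > 0\<close> and to \<open>0\<close> for \<open>s = 0\<close>. The
  general formula at order \<open>0\<close> thus integrates to the mass that the second measure
  gives to \<open>f = 0\<close>.\<close>

lemma tsallis_integrand_order_zero:
  assumes "0 \<le> s" "0 \<le> t"
  shows "tsallis_integrand 0 s t = (if s = 0 then ereal t else 0)"
  using assms by (auto simp: tsallis_integrand_def mixed_power_def enn2ereal_ennreal)

lemma tsallis_integrand_nonneg:
  assumes "0 \<le> s" "0 \<le> t" "0 \<le> a"
  shows "0 \<le> tsallis_integrand a s t"
proof -
  have "0 \<le> tsallis_integrand 0 s t"
    using assms by (simp add: tsallis_integrand_order_zero)
  also have "\<dots> \<le> tsallis_integrand a s t"
    using assms by (intro tsallis_integrand_mono) auto
  finally show ?thesis .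
qed

text \<open>Infinite values arise only for \<open>s > 0\<close>, \<open>t = 0\<close>. There
  finiteness at \<open>b\<close> forces \<open>b < 1\<close>, so \<open>a * s / (1 - a)\<close> is
  valid on all of \<open>{0..b}\<close>.\<close>

lemma continuous_on_tsallis_integrand:
  assumes "0 \<le> s" "0 \<le> t" "0 \<le> b" "tsallis_integrand b s t < \<infinity>"
  shows "continuous_on {0..b} (\<lambda>a. tsallis_integrand a s t)"
proof -
  consider "s = 0" | "0 < s" "t = 0" | "0 < s" "0 < t"
    using assms by linarith
  then show ?thesis
  proof cases
    case 1
    with assms show ?thesis
      by (subst continuous_on_cong[OF refl, where g = "\<lambda>_. ereal t"])
        (auto simp: tsallis_integrand_zero_left)
  next
    case 2
    with assms have "b < 1"
      by (auto simp: tsallis_integrand_zero_right split: if_splits)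
    with 2 show ?thesis
      by (subst continuous_on_cong[OF refl, where g = "\<lambda>a. ereal (a * s / (1 - a))"])
        (auto simp: tsallis_integrand_zero_right intro!: continuous_intros)
  next
    case 3
    then show ?thesis
      by (auto simp: tsallis_integrand_pos intro!: continuous_intros continuous_on_exp_slope)
  qed
qed

section \<open>Homogeneity and measurability in the two densities\<close>

text \<open>The exponents \<open>a\<close> and \<open>1 - a\<close> add up to \<open>1\<close>; the
  boundary values \<open>0\<close> and \<open>\<infinity>\<close> are unchanged by a positive
  factor.\<close>

lemma mixed_power_scale:
  assumes "0 < c" "0 \<le> s" "0 \<le> t"
  shows "mixed_power a (c * s) (c * t) = ennreal c * mixed_power a s t"
proof -
  consider "s = 0" | "0 < s" "t = 0" | "0 < s" "0 < t"
    using assms by linarith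
  then show ?thesis
  proof cases
    case 3
    with assms show ?thesis
      by (simp add: mixed_power_pos ennreal_mult mult.assoc)
  qed (use assms in \<open>auto simp: mixed_power_def ennreal_divide_zero ennreal_mult_top\<close>)
qed

lemma mult_log_quot_scale:
  assumes "0 < c" "0 \<le> s" "0 \<le> t"
  shows "mult_log_quot (c * s) (c * t) = ereal c * mult_log_quot s t"
  using assms by (auto simp: mult_log_quot_def)

lemma tsallis_integrand_scale:
  assumes "0 < c" "0 \<le> s" "0 \<le> t" "0 \<le> a"
  shows "tsallis_integrand a (c * s) (c * t) = ereal c * tsallis_integrand a s t"
proof -
  consider "s = 0" | "0 < s" "t = 0" | "0 < s" "0 < t"
    using assms by linarith
  then show ?thesis
  proof cases
    case 3
    with assms show ?thesis
      by (simp add: tsallis_integrand_pos algebra_simps)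
  qed (use assms in \<open>auto simp: tsallis_integrand_zero_left tsallis_integrand_zero_right\<close>)
qed

text \<open>Carries homogeneity over to positive and negative parts.\<close>

lemma e2ennreal_times_ereal: "0 < c \<Longrightarrow> e2ennreal (ereal c * x) = ennreal c * e2ennreal x"
  by (cases x) (auto simp: ennreal_mult' ennreal_mult_top e2ennreal_neg)

lemma measurable_mixed_power [measurable]:
  "case_prod (mixed_power a) \<in> borel_measurable (borel \<Otimes>\<^sub>M borel)"
  unfolding mixed_power_def[abs_def] by measurable

lemma measurable_mult_log_quot [measurable]:
  "case_prod mult_log_quot \<in> borel_measurable (borel \<Otimes>\<^sub>M borel)"
  unfolding mult_log_quot_def[abs_def] by measurable

lemma measurable_tsallis_integrand [measurable]:
  "case_prod (tsallis_integrand a) \<in> borel_measurable (borel \<Otimes>\<^sub>M borel)"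
  unfolding tsallis_integrand_def[abs_def] by measurable

section \<open>Independence of the dominating measure\<close>

text \<open>Homogeneity with \<open>c = f x + g x\<close> pulls out this factor, which becomes the
  density. Where it vanishes, so do \<open>f x\<close> and \<open>g x\<close>, and
  \<open>h 0 0 = 0\<close> applies.\<close>

lemma nn_integral_eq_sum_density:
  fixes h :: "real \<Rightarrow> real \<Rightarrow> ennreal"
  assumes h [measurable]: "case_prod h \<in> borel_measurable (borel \<Otimes>\<^sub>M borel)"
    and scale: "\<And>c s t. 0 < c \<Longrightarrow> 0 \<le> s \<Longrightarrow> 0 \<le> t \<Longrightarrow> h (c * s) (c * t) = ennreal c * h s t"
    and zero: "h 0 0 = 0"
    and f: "is_real_density L N f" and g: "is_real_density M N g"
  shows "(\<integral>\<^sup>+x. h (f x) (g x) \<partial>N) =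
    (\<integral>\<^sup>+x. h (f x / (f x + g x)) (g x / (f x + g x)) \<partial>density N (\<lambda>x. ennreal (f x + g x)))"
proof -
  have [measurable]: "f \<in> borel_measurable N" "g \<in> borel_measurable N"
    using f g by (auto simp: is_real_density_def)
  have "h (f x) (g x) = ennreal (f x + g x) * h (f x / (f x + g x)) (g x / (f x + g x))"
    if "x \<in> space N" for x
  proof (cases "f x + g x = 0")
    case True
    have "f x = 0" "g x = 0"
      using that True f g by (auto simp: is_real_density_def add_nonneg_eq_0_iff)
    then show ?thesis
      using zero by simp
  next
    case False
    have "0 \<le> f x" "0 \<le> g x"
      using that f g by (auto simp: is_real_density_def)
    then show ?thesis
      using False by (subst scale[symmetric]) auto
  qed
  then show ?thesis
    by (subst nn_integral_density) (auto intro!: nn_integral_cong)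
qed

text \<open>Multiplying the quotient by \<open>f x + g x\<close> gives back \<open>f x\<close> even
  where the sum vanishes, since nonnegativity forces \<open>f x = 0\<close> there.\<close>

lemma density_quotient_by_sum:
  assumes "f \<in> borel_measurable N" "\<forall>x\<in>space N. 0 \<le> f x" "g \<in> borel_measurable N" "\<forall>x\<in>space N. 0 \<le> g x"
  shows "density (density N (\<lambda>x. ennreal (f x + g x))) (\<lambda>x. ennreal (f x / (f x + g x))) =
    density N (\<lambda>x. ennreal (f x))"
  using assms
  by (subst density_density_eq)
    (auto intro!: density_cong AE_I2 simp: ennreal_mult[symmetric] add_nonneg_eq_0_iff simp del: ennreal_plus)

text \<open>Both sides become integrals over the same measure \<open>L + M\<close>, and the
  quotients in them agree almost everywhere, being densities of \<open>L\<close> and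
  \<open>M\<close> with respect to it.\<close>

lemma homogeneous_nn_integral_unique:
  fixes h :: "real \<Rightarrow> real \<Rightarrow> ennreal"
  assumes h [measurable]: "case_prod h \<in> borel_measurable (borel \<Otimes>\<^sub>M borel)"
    and scale: "\<And>c s t. 0 < c \<Longrightarrow> 0 \<le> s \<Longrightarrow> 0 \<le> t \<Longrightarrow> h (c * s) (c * t) = ennreal c * h s t"
    and zero: "h 0 0 = 0"
    and N: "sigma_finite_measure N" "is_real_density L N f" "is_real_density M N g"
    and N': "is_real_density L N' f'" "is_real_density M N' g'"
  shows "(\<integral>\<^sup>+x. h (f' x) (g' x) \<partial>N') = (\<integral>\<^sup>+x. h (f x) (g x) \<partial>N)"
proof -
  note fg = N(2,3)[unfolded is_real_density_def] N'[unfolded is_real_density_def]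
  have [measurable]: "f \<in> borel_measurable N" "g \<in> borel_measurable N"
    "f' \<in> borel_measurable N'" "g' \<in> borel_measurable N'"
    using fg by auto
  define W where "W = density N (\<lambda>x. ennreal (f x + g x))"
  have sets: "sets N' = sets N"
    using fg by (metis sets_density)
  \<comment> \<open>Both measures assign the sum of the \<open>L\<close>- and
    \<open>M\<close>-measures of \<open>A\<close> to a set \<open>A\<close>.\<close>
  have W': "density N' (\<lambda>x. ennreal (f' x + g' x)) = W"
  proof (rule measure_eqI)
    fix A assume "A \<in> sets (density N' (\<lambda>x. ennreal (f' x + g' x)))"
    then have A [measurable]: "A \<in> sets N'" "A \<in> sets N"
      by (auto simp: sets)
    have L: "emeasure (density N f) A = emeasure (density N' f') A"
      and M: "emeasure (density N g) A = emeasure (density N' g') A"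
      using fg by metis+
    have "emeasure (density N' (\<lambda>x. ennreal (f' x + g' x))) A =
        (\<integral>\<^sup>+x. ennreal (f' x) * indicator A x + ennreal (g' x) * indicator A x \<partial>N')"
      using fg by (auto simp: emeasure_density ennreal_plus distrib_right intro!: nn_integral_cong)
    also have "\<dots> = (\<integral>\<^sup>+x. ennreal (f x) * indicator A x + ennreal (g x) * indicator A x \<partial>N)"
      using L M by (simp add: nn_integral_add emeasure_density)
    also have "\<dots> = emeasure W A"
      using fg by (auto simp: W_def emeasure_density ennreal_plus distrib_right intro!: nn_integral_cong)
    finally show "emeasure (density N' (\<lambda>x. ennreal (f' x + g' x))) A = emeasure W A" .
  qed (simp add: W_def sets)
  \<comment> \<open>Sigma-finiteness, on which uniqueness of densities rests, passes from
    \<open>N\<close> to \<open>W\<close> because \<open>f + g\<close> takes only finite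
    values.\<close>
  interpret W: sigma_finite_measure W
    unfolding W_def using N(1) by (subst sigma_finite_measure.sigma_finite_iff_density_finite) auto
  have [measurable]: "f' \<in> borel_measurable N" "g' \<in> borel_measurable N"
    by (simp_all flip: measurable_cong_sets[OF sets refl])
  have [measurable]: "f \<in> borel_measurable W" "g \<in> borel_measurable W"
    "f' \<in> borel_measurable W" "g' \<in> borel_measurable W"
    by (simp_all add: W_def)
  have "density W (\<lambda>x. ennreal (f x / (f x + g x))) = density W (\<lambda>x. ennreal (f' x / (f' x + g' x)))"
    using density_quotient_by_sum[of f N g] density_quotient_by_sum[of f' N' g'] fg unfolding W' by (simp add: W_def)
  then have 1: "AE x in W. ennreal (f x / (f x + g x)) = ennreal (f' x / (f' x + g' x))"
    by (intro W.density_unique) auto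
  have "density W (\<lambda>x. ennreal (g x / (f x + g x))) = density W (\<lambda>x. ennreal (g' x / (f' x + g' x)))"
    using density_quotient_by_sum[of g N f] density_quotient_by_sum[of g' N' f'] fg W' by (simp add: W_def add.commute)
  then have 2: "AE x in W. ennreal (g x / (f x + g x)) = ennreal (g' x / (f' x + g' x))"
    by (intro W.density_unique) auto
  \<comment> \<open>Uniqueness yields equal \<open>ennreal\<close> values; nonnegativity makes the
    underlying reals equal.\<close>
  have nn: "AE x in W. 0 \<le> f x \<and> 0 \<le> g x \<and> 0 \<le> f' x \<and> 0 \<le> g' x"
    using fg sets_eq_imp_space_eq[OF sets] by (intro AE_I2) (auto simp: W_def)
  have ae: "AE x in W. h (f' x / (f' x + g' x)) (g' x / (f' x + g' x)) = h (f x / (f x + g x)) (g x / (f x + g x))"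
    using 1 2 nn by eventually_elim auto
  have "(\<integral>\<^sup>+x. h (f' x) (g' x) \<partial>N') = (\<integral>\<^sup>+x. h (f' x / (f' x + g' x)) (g' x / (f' x + g' x)) \<partial>W)"
    using nn_integral_eq_sum_density[OF h scale zero N'] by (simp add: W')
  also have "\<dots> = (\<integral>\<^sup>+x. h (f x / (f x + g x)) (g x / (f x + g x)) \<partial>W)"
    by (intro nn_integral_cong_AE ae)
  also have "\<dots> = (\<integral>\<^sup>+x. h (f x) (g x) \<partial>N)"
    using nn_integral_eq_sum_density[OF h scale zero N(2,3)] by (simp add: W_def)
  finally show ?thesis .
qed

text \<open>A factor \<open>c > 0\<close> preserves signs, so the positive and negative parts of
  \<open>h\<close> are homogeneous too and can be treated separately.\<close>

lemma homogeneous_ext_integral_unique: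
  fixes h :: "real \<Rightarrow> real \<Rightarrow> ereal"
  assumes h [measurable]: "case_prod h \<in> borel_measurable (borel \<Otimes>\<^sub>M borel)"
    and scale: "\<And>c s t. 0 < c \<Longrightarrow> 0 \<le> s \<Longrightarrow> 0 \<le> t \<Longrightarrow> h (c * s) (c * t) = ereal c * h s t"
    and zero: "h 0 0 = 0"
    and N: "sigma_finite_measure N" "is_real_density L N f" "is_real_density M N g"
    and N': "is_real_density L N' f'" "is_real_density M N' g'"
  shows "ext_integral N' (\<lambda>x. h (f' x) (g' x)) = ext_integral N (\<lambda>x. h (f x) (g x))"
proof -
  have "(\<integral>\<^sup>+x. e2ennreal (h (f' x) (g' x)) \<partial>N') = (\<integral>\<^sup>+x. e2ennreal (h (f x) (g x)) \<partial>N)"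
    by (rule homogeneous_nn_integral_unique[OF _ _ _ N N'])
      (simp_all add: scale zero e2ennreal_times_ereal e2ennreal_neg)
  moreover have "(\<integral>\<^sup>+x. e2ennreal (- h (f' x) (g' x)) \<partial>N') = (\<integral>\<^sup>+x. e2ennreal (- h (f x) (g x)) \<partial>N)"
    by (rule homogeneous_nn_integral_unique[OF _ _ _ N N'])
      (simp_all add: scale zero e2ennreal_times_ereal e2ennreal_neg flip: ereal_mult_minus_right)
  ultimately show ?thesis
    by (simp add: ext_integral_def)
qed

section \<open>Well-definedness of the Renyi divergence\<close>

text \<open>Again \<open>0 powr 0 = 0\<close> is decisive: it cuts the integrand off where
  \<open>p\<close> vanishes. Order \<open>0\<close> thereby becomes the integral of a homogeneous
  function.\<close>

lemma emeasure_density_pos_set: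
  assumes "is_real_density P M p" "is_real_density Q M q"
  shows "emeasure (density M (\<lambda>x. ennreal (q x))) {x \<in> space M. p x > 0} =
    (\<integral>\<^sup>+x. mixed_power 0 (p x) (q x) \<partial>M)"
proof -
  have [measurable]: "p \<in> borel_measurable M" "q \<in> borel_measurable M"
    using assms by (auto simp: is_real_density_def)
  show ?thesis
    using assms
    by (subst emeasure_density)
      (force simp: is_real_density_def mixed_power_def indicator_def intro!: nn_integral_cong)+
qed

text \<open>Every branch sees the densities only through integrals of the homogeneous functions
  \<open>mixed_power\<close> and \<open>mult_log_quot\<close>.\<close>

lemma renyi_of_densities_unique:
  assumes "sigma_finite_measure M" "is_real_density P M p" "is_real_density Q M q"
    and "is_real_density P M' p'" "is_real_density Q M' q'"
  shows "renyi_of_densities a M' p' q' = renyi_of_densities a M p q"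
proof -
  have "(\<integral>\<^sup>+x. mixed_power a (p' x) (q' x) \<partial>M') = (\<integral>\<^sup>+x. mixed_power a (p x) (q x) \<partial>M)" for a
    by (rule homogeneous_nn_integral_unique[OF _ _ _ assms])
      (simp_all add: mixed_power_scale, simp add: mixed_power_def)
  moreover have "ext_integral M' (\<lambda>x. mult_log_quot (p' x) (q' x)) = ext_integral M (\<lambda>x. mult_log_quot (p x) (q x))"
    by (rule homogeneous_ext_integral_unique[OF _ _ _ assms])
      (simp_all add: mult_log_quot_scale, simp add: mult_log_quot_def)
  ultimately show ?thesis
    using emeasure_density_pos_set[OF assms(2,3)] emeasure_density_pos_set[OF assms(4,5)]
    by (simp add: renyi_of_densities_def)
qed

text \<open>Any sigma-finite dominating measure may serve for computation, in particular counting
  measure for distributions on a countable type.\<close>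

lemma renyi_eq_renyi_of_densities:
  assumes "sigma_finite_measure M" "is_real_density P M p" "is_real_density Q M q"
  shows "renyi a P Q = renyi_of_densities a M p q"
  unfolding renyi_def using assms renyi_of_densities_unique by (intro the_equality) blast+

lemma is_real_density_pmf: "is_real_density (measure_pmf P) (count_space UNIV) (pmf P)"
  by (simp add: is_real_density_def flip: measure_pmf_eq_density)

lemma renyi_pmf:
  fixes P Q :: "'a :: countable pmf"
  shows "renyi a P Q = renyi_of_densities a (count_space UNIV) (pmf P) (pmf Q)"
  by (intro renyi_eq_renyi_of_densities is_real_density_pmf sigma_finite_measure_count_space)

section \<open>Renyi divergence between Poisson distributions\<close>

text \<open>At \<open>s = 0\<close> the convention \<open>0 ^ 0 = 1\<close> gives the point mass at
  \<open>0\<close>.\<close>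

lemma pmf_poisson_eq:
  assumes "0 \<le> s"
  shows "pmf (poisson s) k = s ^ k / fact k * exp (- s)"
  using assms by (cases k) (auto simp: poisson_def)

lemma nn_integral_exp_series:
  assumes "0 \<le> y" "0 \<le> c"
  shows "(\<integral>\<^sup>+k. ennreal (c * (y ^ k / fact k)) \<partial>count_space UNIV) = ennreal (c * exp y)"
proof -
  have "(\<lambda>k. c * (y ^ k / fact k)) sums (c * exp y)"
    using sums_mult[OF exp_converges[of y], of c] by (simp add: field_simps)
  then show ?thesis
    using assms unfolding nn_integral_count_space_nat by (intro suminf_ennreal_eq) auto
qed

text \<open>Up to a constant factor the mixed power of two Poisson weights is
  \<open>y ^ k / fact k\<close> with \<open>y = t * exp (a * ln (s / t))\<close>, so an exponential
  series is summed.\<close>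

lemma nn_integral_mixed_power_poisson:
  assumes "0 < s" "0 < t"
  shows "(\<integral>\<^sup>+k. mixed_power a (pmf (poisson s) k) (pmf (poisson t) k) \<partial>count_space UNIV) =
    ennreal (exp (a * (t - s) - t + t * exp (a * ln (s / t))))"
proof -
  have "mixed_power a (pmf (poisson s) k) (pmf (poisson t) k) =
      ennreal (exp (a * (t - s) - t) * ((t * exp (a * ln (s / t))) ^ k / fact k))" for k
  proof -
    \<comment> \<open>The factorials cancel, which leaves a log-likelihood ratio affine in
      \<open>k\<close>.\<close>
    have "ln (pmf (poisson s) k / pmf (poisson t) k) = t - s + real k * ln (s / t)"
      using assms by (simp add: pmf_poisson_eq ln_mult ln_div ln_realpow algebra_simps)
    then have "mixed_power a (pmf (poisson s) k) (pmf (poisson t) k) =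
        ennreal (pmf (poisson t) k * exp (a * (t - s + real k * ln (s / t))))"
      using assms by (subst mixed_power_pos) (simp_all add: pmf_poisson_eq)
    also have "pmf (poisson t) k * exp (a * (t - s + real k * ln (s / t))) =
        t ^ k / fact k * (exp (- t) * exp (a * (t - s)) * exp (real k * (a * ln (s / t))))"
      using assms by (simp add: pmf_poisson_eq algebra_simps flip: exp_add)
    also have "exp (real k * (a * ln (s / t))) = exp (a * ln (s / t)) ^ k"
      by (rule exp_of_nat_mult)
    also have "exp (- t) * exp (a * (t - s)) = exp (a * (t - s) - t)"
      by (simp flip: exp_add)
    finally show ?thesis
      by (simp add: power_mult_distrib mult_ac)
  qed
  then show ?thesis
    using assms by (simp only:) (subst nn_integral_exp_series, simp_all flip: exp_add)
qed

text \<open>Serves the degenerate rate, as \<open>poisson 0\<close> is concentrated at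
  \<open>0\<close>.\<close>

lemma nn_integral_count_space_only_zero:
  fixes h :: "nat \<Rightarrow> ennreal"
  assumes "\<And>k. k \<noteq> 0 \<Longrightarrow> h k = 0"
  shows "(\<integral>\<^sup>+k. h k \<partial>count_space UNIV) = h 0"
  using assms by (subst nn_integral_count_space'[of "{0}"]) auto

text \<open>The logarithm of the ratio is affine in \<open>k\<close>, so only the total mass
  \<open>1\<close> and the mean \<open>s\<close> enter.\<close>

lemma ext_integral_mult_log_quot_poisson:
  assumes "0 < s" "0 < t"
  shows "ext_integral (count_space UNIV) (\<lambda>k. mult_log_quot (pmf (poisson s) k) (pmf (poisson t) k)) =
    ereal (t - s + s * ln (s / t))"
proof -
  define c where "c = ln (s / t)"
  define u where "u k = pmf (poisson s) k * (t - s + real k * c)" for k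
  have u: "mult_log_quot (pmf (poisson s) k) (pmf (poisson t) k) = ereal (u k)" for k
    using assms by (simp add: mult_log_quot_def u_def c_def pmf_poisson_eq ln_mult ln_div ln_realpow algebra_simps)
  have "pmf (poisson s) = (\<lambda>k. exp (- s) * (s ^ k /\<^sub>R fact k))"
    using assms by (auto simp: pmf_poisson_eq field_simps)
  then have pmf_sums: "pmf (poisson s) sums 1"
    using sums_mult[OF exp_converges[of s], of "exp (- s)"] by (simp flip: exp_add)
  \<comment> \<open>This shift identity reduces the mean to the total mass; undoing the shift adds
    only the vanishing term at \<open>k = 0\<close>.\<close>
  have Suc: "real (Suc k) * pmf (poisson s) (Suc k) = s * pmf (poisson s) k" for k
    using assms by (simp add: pmf_poisson_eq field_simps del: of_nat_Suc)
  have "(\<lambda>k. real (Suc k) * pmf (poisson s) (Suc k)) sums s"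
    unfolding Suc using sums_mult[OF pmf_sums, of s] by simp
  then have mean_sums: "(\<lambda>k. real k * pmf (poisson s) k) sums s"
    by (subst (asm) sums_Suc_iff) simp
  have "(\<lambda>k. (t - s) * pmf (poisson s) k + c * (real k * pmf (poisson s) k)) sums ((t - s) * 1 + c * s)"
    by (intro sums_add sums_mult pmf_sums mean_sums)
  then have u_sums: "u sums (t - s + s * c)"
    by (simp add: u_def[abs_def] algebra_simps)
  \<comment> \<open>Absolute summability makes both parts of \<open>u\<close> have finite integrals,
    so \<open>ext_integral\<close> is the ordinary integral.\<close>
  have "summable (\<lambda>k. norm (u k))"
  proof (rule summable_comparison_test)
    have "norm (u n) \<le> \<bar>t - s\<bar> * pmf (poisson s) n + \<bar>c\<bar> * (real n * pmf (poisson s) n)" for n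
    proof -
      have "u n = (t - s) * pmf (poisson s) n + c * (real n * pmf (poisson s) n)"
        unfolding u_def by (simp add: algebra_simps)
      then show ?thesis
        using abs_triangle_ineq[of "(t - s) * pmf (poisson s) n" "c * (real n * pmf (poisson s) n)"]
        by (simp only: abs_mult real_norm_def abs_of_nat) simp
    qed
    then show "\<exists>N. \<forall>n\<ge>N. norm (norm (u n)) \<le> \<bar>t - s\<bar> * pmf (poisson s) n + \<bar>c\<bar> * (real n * pmf (poisson s) n)"
      by simp
    show "summable (\<lambda>n. \<bar>t - s\<bar> * pmf (poisson s) n + \<bar>c\<bar> * (real n * pmf (poisson s) n))"
      by (intro summable_add summable_mult sums_summable[OF pmf_sums] sums_summable[OF mean_sums])
  qed
  then have int: "integrable (count_space UNIV) u"
    by (simp add: integrable_count_space_nat_iff)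
  then have integral: "integral\<^sup>L (count_space UNIV) u = t - s + s * c"
    using sums_unique2[OF sums_integral_count_space_nat u_sums] by simp
  have fin: "(\<integral>\<^sup>+k. ennreal (u k) \<partial>count_space UNIV) \<noteq> \<infinity>" "(\<integral>\<^sup>+k. ennreal (- u k) \<partial>count_space UNIV) \<noteq> \<infinity>"
    using int by (simp_all add: real_integrable_def)
  have "ext_integral (count_space UNIV) (\<lambda>k. mult_log_quot (pmf (poisson s) k) (pmf (poisson t) k)) =
      enn2ereal (\<integral>\<^sup>+k. ennreal (u k) \<partial>count_space UNIV) - enn2ereal (\<integral>\<^sup>+k. ennreal (- u k) \<partial>count_space UNIV)"
    by (simp add: ext_integral_def u)
  also have "\<dots> = ereal (integral\<^sup>L (count_space UNIV) u)"
    using fin unfolding real_lebesgue_integral_def[OF int]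
    by (cases "\<integral>\<^sup>+k. ennreal (u k) \<partial>count_space UNIV"; cases "\<integral>\<^sup>+k. ennreal (- u k) \<partial>count_space UNIV") (auto simp: enn2ereal_ennreal)
  finally show ?thesis
    by (simp add: integral c_def)
qed

text \<open>Only \<open>k = 0\<close> contributes, with weights \<open>1\<close> and
  \<open>exp (- t)\<close>, and their log-ratio is \<open>t\<close> at every order.\<close>

lemma renyi_poisson_zero_left:
  assumes "0 \<le> a" "0 \<le> t"
  shows "renyi a (poisson 0) (poisson t) = ereal t"
proof -
  have [simp]: "pmf (poisson 0) k = (if k = 0 then 1 else 0)" for k
    by (simp add: pmf_poisson_eq)
  \<comment> \<open>Stated for all orders, since its instance at \<open>0\<close> yields
    \<open>em\<close>.\<close>
  have mp: "(\<integral>\<^sup>+k. mixed_power a (pmf (poisson 0) k) (pmf (poisson t) k) \<partial>count_space UNIV) = ennreal (exp ((a - 1) * t))" for a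
  proof (subst nn_integral_count_space_only_zero)
    have "exp (- t) * exp (a * t) = exp ((a - 1) * t)"
      by (simp add: algebra_simps flip: exp_add)
    then show "mixed_power a (pmf (poisson 0) 0) (pmf (poisson t) 0) = ennreal (exp ((a - 1) * t))"
      using assms by (simp add: mixed_power_pos pmf_poisson_eq ln_div)
  qed (auto simp: mixed_power_def)
  have em: "emeasure (density (count_space UNIV) (\<lambda>k. ennreal (pmf (poisson t) k)))
      {k \<in> space (count_space UNIV). pmf (poisson 0) k > 0} = ennreal (exp (- t))"
    using mp[of 0] emeasure_density_pos_set[OF is_real_density_pmf is_real_density_pmf, of "poisson t" "poisson 0"] by simp
  have 1: "ext_integral (count_space UNIV) (\<lambda>k. mult_log_quot (pmf (poisson 0) k) (pmf (poisson t) k)) = ereal t"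
  proof -
    have "(\<integral>\<^sup>+k. e2ennreal (mult_log_quot (pmf (poisson 0) k) (pmf (poisson t) k)) \<partial>count_space UNIV) = ennreal t"
      "(\<integral>\<^sup>+k. e2ennreal (- mult_log_quot (pmf (poisson 0) k) (pmf (poisson t) k)) \<partial>count_space UNIV) = 0"
      by (subst nn_integral_count_space_only_zero;
        use assms in \<open>simp add: mult_log_quot_def pmf_poisson_eq ln_div e2ennreal_neg ennreal_neg\<close>)+
    with assms show ?thesis
      by (simp add: ext_integral_def enn2ereal_ennreal zero_ennreal.rep_eq)
  qed
  show ?thesis
    unfolding renyi_pmf renyi_of_densities_def mp em 1
    by (auto simp: ext_log_def)
qed

text \<open>Below order \<open>1\<close> only \<open>k = 0\<close> survives. From order
  \<open>1\<close> on, the atom \<open>k = 1\<close>, charged by \<open>poisson s\<close> but not by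
  \<open>poisson 0\<close>, already makes the divergence infinite.\<close>

lemma renyi_poisson_zero_right:
  assumes "0 \<le> a" "0 < s"
  shows "renyi a (poisson s) (poisson 0) = tsallis_integrand a s 0"
proof -
  have [simp]: "pmf (poisson 0) k = (if k = 0 then 1 else 0)" for k
    by (simp add: pmf_poisson_eq)
  have lt1: "(\<integral>\<^sup>+k. mixed_power a (pmf (poisson s) k) (pmf (poisson 0) k) \<partial>count_space UNIV) = ennreal (exp (- a * s))"
    if "a < 1" for a
    by (subst nn_integral_count_space_only_zero)
      (use assms that in \<open>auto simp: mixed_power_def pmf_poisson_eq powr_def\<close>)
  consider "a = 0" | "0 < a" "a < 1" | "a = 1" | "1 < a"
    using assms by linarith
  then show ?thesis
  proof cases
    case 1
    have "emeasure (density (count_space UNIV) (\<lambda>k. ennreal (pmf (poisson 0) k)))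
        {k \<in> space (count_space UNIV). pmf (poisson s) k > 0} = 1"
      using lt1[of 0] emeasure_density_pos_set[OF is_real_density_pmf is_real_density_pmf, of "poisson 0" "poisson s"] by simp
    with 1 assms show ?thesis
      unfolding renyi_pmf renyi_of_densities_def
      by (simp add: ext_log_def tsallis_integrand_zero_right)
  next
    case 2
    then show ?thesis
      unfolding renyi_pmf renyi_of_densities_def
      using assms by (simp add: lt1[simplified] ext_log_def tsallis_integrand_zero_right divide_simps)
        (simp add: algebra_simps)
  next
    case 3
    have "e2ennreal (mult_log_quot (pmf (poisson s) 1) (pmf (poisson 0) 1)) \<le>
        (\<integral>\<^sup>+k. e2ennreal (mult_log_quot (pmf (poisson s) k) (pmf (poisson 0) k)) \<partial>count_space UNIV)"
      by (rule nn_integral_ge_point) simp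
    then have pos: "(\<integral>\<^sup>+k. e2ennreal (mult_log_quot (pmf (poisson s) k) (pmf (poisson 0) k)) \<partial>count_space UNIV) = \<infinity>"
      using assms by (simp add: mult_log_quot_def pmf_poisson_eq top_unique)
    \<comment> \<open>Only \<open>k = 0\<close> gives a negative value,
      \<open>- s * exp (- s)\<close>; since this part is finite, the difference of the two integrals
      is \<open>\<infinity>\<close>.\<close>
    have neg: "(\<integral>\<^sup>+k. e2ennreal (- mult_log_quot (pmf (poisson s) k) (pmf (poisson 0) k)) \<partial>count_space UNIV) = ennreal (s * exp (- s))"
      by (subst nn_integral_count_space_only_zero)
        (use assms in \<open>auto simp: mult_log_quot_def pmf_poisson_eq e2ennreal_neg mult.commute\<close>)
    show ?thesis
      unfolding renyi_pmf renyi_of_densities_def ext_integral_def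
      using 3 assms unfolding pos neg by (simp add: tsallis_integrand_zero_right enn2ereal_ennreal)
  next
    case 4
    have "mixed_power a (pmf (poisson s) 1) (pmf (poisson 0) 1) \<le>
        (\<integral>\<^sup>+k. mixed_power a (pmf (poisson s) k) (pmf (poisson 0) k) \<partial>count_space UNIV)"
      by (rule nn_integral_ge_point) simp
    then have "(\<integral>\<^sup>+k. mixed_power a (pmf (poisson s) k) (pmf (poisson 0) k) \<partial>count_space UNIV) = \<infinity>"
      using 4 assms by (simp add: mixed_power_def pmf_poisson_eq ennreal_divide_zero top_unique)
    then show ?thesis
      unfolding renyi_pmf renyi_of_densities_def
      using 4 assms by (simp add: ext_log_def tsallis_integrand_zero_right)
  qed
qed

text \<open>Pointwise form of the integral representation: for positive rates and orders other than
  \<open>0\<close> and \<open>1\<close>, the exponent found for the series, divided by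
  \<open>a - 1\<close>, is the Tsallis integrand.\<close>

lemma renyi_poisson:
  assumes "0 \<le> a" "0 \<le> s" "0 \<le> t"
  shows "renyi a (poisson s) (poisson t) = tsallis_integrand a s t"
proof -
  consider "s = 0" | "0 < s" "t = 0" | "0 < s" "0 < t"
    using assms by linarith
  then show ?thesis
  proof cases
    case 1
    with assms show ?thesis
      by (simp add: renyi_poisson_zero_left tsallis_integrand_zero_left)
  next
    case 2
    with assms show ?thesis
      by (simp add: renyi_poisson_zero_right)
  next
    case 3
    note mp = nn_integral_mixed_power_poisson[OF 3]
    \<comment> \<open>For \<open>s > 0\<close> every \<open>k\<close> is charged by
      \<open>poisson s\<close>, so order \<open>0\<close> gives divergence \<open>0\<close>.\<close>
    have em: "emeasure (density (count_space UNIV) (\<lambda>k. ennreal (pmf (poisson t) k)))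
        {k \<in> space (count_space UNIV). pmf (poisson s) k > 0} = 1"
      using mp[of 0] emeasure_density_pos_set[OF is_real_density_pmf is_real_density_pmf, of "poisson t" "poisson s"] by simp
    have e: "exp (ln (s / t)) = s / t"
      using 3 by simp
    consider "a = 0" | "a = 1" | "a \<noteq> 0" "a \<noteq> 1"
      by blast
    then show ?thesis
    proof cases
      case 1
      with 3 show ?thesis
        unfolding renyi_pmf renyi_of_densities_def em
        by (simp add: ext_log_def tsallis_integrand_order_zero)
    next
      case 2
      with 3 show ?thesis
        unfolding renyi_pmf renyi_of_densities_def ext_integral_mult_log_quot_poisson[OF 3]
        by (simp add: tsallis_integrand_pos exp_slope_def)
    next
      case a: 3
      with 3 show ?thesis
        unfolding renyi_pmf renyi_of_densities_def mp tsallis_integrand_pos[OF 3] exp_slope_def e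
        by (simp add: ext_log_def divide_simps) (simp add: algebra_simps)
    qed
  qed
qed

section \<open>The Tsallis divergence as a function of the order\<close>

text \<open>Absorbs the separately defined order \<open>0\<close> into the integral formula, so that
  all orders can be treated at once.\<close>

lemma tsallis_eq_ext_integral:
  assumes "is_real_density L N f" "is_real_density M N g"
  shows "tsallis a N f g = ext_integral N (\<lambda>x. tsallis_integrand a (f x) (g x))"
proof (cases "a = 0")
  case True
  have [measurable]: "f \<in> borel_measurable N" "g \<in> borel_measurable N"
    and nn: "\<And>x. x \<in> space N \<Longrightarrow> 0 \<le> f x" "\<And>x. x \<in> space N \<Longrightarrow> 0 \<le> g x"
    using assms by (auto simp: is_real_density_def)
  have "emeasure (density N (\<lambda>x. ennreal (g x))) {x \<in> space N. f x = 0} =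
      (\<integral>\<^sup>+x. e2ennreal (tsallis_integrand 0 (f x) (g x)) \<partial>N)"
    by (subst emeasure_density)
      (auto intro!: nn_integral_cong simp: tsallis_integrand_order_zero nn indicator_def e2ennreal_neg)
  moreover have "(\<integral>\<^sup>+x. e2ennreal (- tsallis_integrand 0 (f x) (g x)) \<partial>N) = (\<integral>\<^sup>+x. 0 \<partial>N)"
    by (intro nn_integral_cong e2ennreal_neg) (simp add: tsallis_integrand_nonneg nn)
  ultimately show ?thesis
    using True by (simp add: tsallis_def ext_integral_def zero_ennreal.rep_eq)
qed (simp add: tsallis_def)

theorem theorem3p1:
  fixes L M N :: "'a measure" and f g :: "'a \<Rightarrow> real"
  assumes "sigma_finite_measure L" and "sigma_finite_measure M" and "sigma_finite_measure N"
    and "is_real_density L N f" and "is_real_density M N g"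
  shows "(\<forall>a>0. ext_integral_exists N (\<lambda>x. tsallis_integrand a (f x) (g x))) \<and>
    (\<forall>a\<ge>0. 0 \<le> tsallis a N f g) \<and>
    mono_on {0..} (\<lambda>a. tsallis a N f g) \<and>
    is_interval {a. 0 \<le> a \<and> tsallis a N f g < \<infinity>} \<and>
    continuous_on {a. 0 \<le> a \<and> tsallis a N f g < \<infinity>} (\<lambda>a. tsallis a N f g) \<and>
    (\<forall>a\<ge>0. ext_integral_exists N (\<lambda>x. renyi a (poisson (f x)) (poisson (g x))) \<and>
       tsallis a N f g = ext_integral N (\<lambda>x. renyi a (poisson (f x)) (poisson (g x)))) \<and>
    (\<forall>N' f' g'. sigma_finite_measure N' \<and> is_real_density L N' f' \<and> is_real_density M N' g' \<longrightarrow>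
       (\<forall>a\<ge>0. tsallis a N' f' g' = tsallis a N f g))"
proof -
  have [measurable]: "f \<in> borel_measurable N" "g \<in> borel_measurable N"
    and nn: "\<And>x. x \<in> space N \<Longrightarrow> 0 \<le> f x" "\<And>x. x \<in> space N \<Longrightarrow> 0 \<le> g x"
    using assms(4,5) by (auto simp: is_real_density_def)
  let ?T = "\<lambda>a x. tsallis_integrand a (f x) (g x)"
  \<comment> \<open>The negative part vanishes, so \<open>I a\<close> is the divergence as an
    \<open>ennreal\<close>, the setting for dominated convergence of nonnegative functions.\<close>
  define I where "I a = (\<integral>\<^sup>+x. e2ennreal (?T a x) \<partial>N)" for a
  have neg: "(\<integral>\<^sup>+x. e2ennreal (- ?T a x) \<partial>N) = 0" if "0 \<le> a" for a
  proof -
    have "(\<integral>\<^sup>+x. e2ennreal (- ?T a x) \<partial>N) = (\<integral>\<^sup>+x. 0 \<partial>N)"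
      by (intro nn_integral_cong e2ennreal_neg) (simp add: tsallis_integrand_nonneg nn that)
    then show ?thesis
      by simp
  qed
  have tsallis: "tsallis a N f g = enn2ereal (I a)" if "0 \<le> a" for a
    by (simp add: tsallis_eq_ext_integral[OF assms(4,5)] ext_integral_def I_def neg that zero_ennreal.rep_eq)
  have exists: "ext_integral_exists N (?T a)" if "0 \<le> a" for a
    by (simp add: ext_integral_exists_def neg that)
  have mono: "I a \<le> I b" if "0 \<le> a" "a \<le> b" for a b
    unfolding I_def using that nn by (intro nn_integral_mono e2ennreal_mono tsallis_integrand_mono)
  have fin_iff: "enn2ereal (I a) < \<infinity> \<longleftrightarrow> I a < \<infinity>" for a
    by (cases "I a") (auto simp: enn2ereal_ennreal)
  define D where "D = {a. 0 \<le> a \<and> I a < \<infinity>}"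
  have D: "{a. 0 \<le> a \<and> tsallis a N f g < \<infinity>} = D"
    unfolding D_def using tsallis fin_iff by auto
  have "is_interval D"
    unfolding is_interval_1
  proof (intro ballI allI impI, elim conjE)
    fix a b c
    assume *: "a \<in> D" "b \<in> D" "a \<le> c" "c \<le> b"
    then have "0 \<le> c" "I b < \<infinity>"
      by (simp_all add: D_def)
    then show "c \<in> D"
      using le_less_trans[OF mono[OF \<open>0 \<le> c\<close> *(4)]] by (simp add: D_def)
  qed
  have cont: "continuous_on D I"
    unfolding continuous_on_sequentially comp_def
  proof (intro allI ballI impI, elim conjE)
    fix X a
    assume "a \<in> D" and X: "\<forall>n. X n \<in> D" "X \<longlonglongrightarrow> a"
    \<comment> \<open>\<open>I b\<close> is the dominating integral: if no point of \<open>D\<close> lies to the right of \<open>a\<close>, then the whole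
      sequence stays below \<open>a\<close> and \<open>b = a\<close> works.\<close>
    obtain b where b: "b \<in> D" "a \<le> b" "\<forall>\<^sub>F n in sequentially. X n \<le> b"
    proof (cases "\<exists>b\<in>D. a < b")
      case True
      then obtain b where "b \<in> D" "a < b"
        by blast
      have "\<forall>\<^sub>F n in sequentially. X n \<le> b"
        using order_tendstoD(2)[OF X(2) \<open>a < b\<close>] by (rule eventually_mono) simp
      then show ?thesis
        by (rule that[OF \<open>b \<in> D\<close> less_imp_le[OF \<open>a < b\<close>]])
    next
      case False
      then have "\<forall>\<^sub>F n in sequentially. X n \<le> a"
        using X(1) by (intro always_eventually) (meson not_less)
      then show ?thesis
        by (rule that[OF \<open>a \<in> D\<close> order_refl])
    qed
    \<comment> \<open>Domination holds only from \<open>n0\<close> on; the limit is taken along the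
      shifted sequence.\<close>
    then obtain n0 where n0: "\<And>n. n0 \<le> n \<Longrightarrow> X n \<le> b"
      by (auto simp: eventually_sequentially)
    have X0: "0 \<le> X n" for n
      using X(1) by (simp add: D_def)
    have "0 \<le> a" "0 \<le> b" "I b < \<infinity>"
      using \<open>a \<in> D\<close> b(1) by (auto simp: D_def)
    \<comment> \<open>A finite integral at \<open>b\<close> makes the integrand at \<open>b\<close>
      finite almost everywhere, as pointwise continuity on \<open>{0..b}\<close> requires.\<close>
    have "AE x in N. e2ennreal (?T b x) \<noteq> \<infinity>"
      using \<open>I b < \<infinity>\<close> unfolding I_def by (intro nn_integral_noteq_infinite) auto
    then have lim: "AE x in N. (\<lambda>n. e2ennreal (?T (X (n + n0)) x)) \<longlonglongrightarrow> e2ennreal (?T a x)"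
      using AE_space
    proof eventually_elim
      case (elim x)
      have "?T b x < \<infinity>"
        using elim(1) by (cases "?T b x") auto
      then have "continuous_on {0..b} (\<lambda>a. ?T a x)"
        using elim nn \<open>0 \<le> b\<close> by (intro continuous_on_tsallis_integrand) auto
      then have "(\<lambda>n. ?T (X (n + n0)) x) \<longlonglongrightarrow> ?T a x"
        by (rule continuous_on_tendsto_compose[OF _ LIMSEQ_ignore_initial_segment[OF X(2), of n0]])
          (use \<open>0 \<le> a\<close> b(2) X0 n0 in \<open>auto intro: always_eventually\<close>)
      then show ?case
        by (rule tendsto_e2ennrealI)
    qed
    have "(\<lambda>n. I (X (n + n0))) \<longlonglongrightarrow> I a"
      unfolding I_def
    proof (rule nn_integral_dominated_convergence[where w = "\<lambda>x. e2ennreal (?T b x)"])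
      show "AE x in N. e2ennreal (?T (X (n + n0)) x) \<le> e2ennreal (?T b x)" for n
        using nn X0 n0 by (intro AE_I2 e2ennreal_mono tsallis_integrand_mono) auto
    qed (use lim \<open>I b < \<infinity>\<close> in \<open>auto simp: I_def\<close>)
    then show "(\<lambda>n. I (X n)) \<longlonglongrightarrow> I a"
      by (rule LIMSEQ_offset)
  qed
  have "continuous_on D (\<lambda>a. tsallis a N f g)"
    using continuous_on_enn2ereal[THEN continuous_on_compose2, OF cont]
    by (subst continuous_on_cong[OF refl, where g = "\<lambda>a. enn2ereal (I a)"]) (auto simp: D_def tsallis)
  moreover have "ext_integral_exists N (\<lambda>x. renyi a (poisson (f x)) (poisson (g x))) \<and>
      tsallis a N f g = ext_integral N (\<lambda>x. renyi a (poisson (f x)) (poisson (g x)))" if "0 \<le> a" for a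
  proof -
    \<comment> \<open>Restricted to \<open>space N\<close>, where \<open>f\<close> and
      \<open>g\<close> are known to be nonnegative.\<close>
    have eq: "renyi a (poisson (f x)) (poisson (g x)) = ?T a x" if "x \<in> space N" for x
      using that nn \<open>0 \<le> a\<close> by (intro renyi_poisson)
    have "ext_integral_exists N (\<lambda>x. renyi a (poisson (f x)) (poisson (g x))) \<longleftrightarrow> ext_integral_exists N (?T a)"
      unfolding ext_integral_exists_def by (simp add: eq cong: nn_integral_cong measurable_cong)
    moreover have "ext_integral N (\<lambda>x. renyi a (poisson (f x)) (poisson (g x))) = ext_integral N (?T a)"
      unfolding ext_integral_def by (simp add: eq cong: nn_integral_cong)
    ultimately show ?thesis
      using exists[OF that] tsallis_eq_ext_integral[OF assms(4,5)] by simp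
  qed
  moreover have "tsallis a N' f' g' = tsallis a N f g"
    if "is_real_density L N' f'" "is_real_density M N' g'" "0 \<le> a" for N' :: "'a measure" and f' g' a
  proof -
    have "ext_integral N' (\<lambda>x. tsallis_integrand a (f' x) (g' x)) = ext_integral N (?T a)"
      by (rule homogeneous_ext_integral_unique[OF _ _ _ assms(3-5) that(1,2)])
        (use that in \<open>simp_all add: tsallis_integrand_scale tsallis_integrand_zero_left\<close>)
    then show ?thesis
      using tsallis_eq_ext_integral[OF assms(4,5)] tsallis_eq_ext_integral[OF that(1,2)] by simp
  qed
  moreover have "mono_on {0..} (\<lambda>a. tsallis a N f g)"
    by (intro mono_onI) (simp add: tsallis mono flip: less_eq_ennreal.rep_eq)
  moreover have "0 \<le> tsallis a N f g" if "0 \<le> a" for a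
    using that by (simp add: tsallis)
  ultimately show ?thesis
    unfolding D using exists \<open>is_interval D\<close> by (intro conjI allI impI; (elim conjE)?) auto
qed

end
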